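(* Let $X_1,X_2,\ldots$ and $Y_1,Y_2,\ldots$ be two independent sequences of i.i.d. unit exponential random variables, and for each $n$ let $X_{(1)}\le\cdots\le X_{(n)}$ and $Y_{(1)}\le\cdots\le Y_{(n)}$ be the order statistics of $X_1,\ldots,X_n$ and $Y_1,\ldots,Y_n$ respectively. Then for every fixed positive integer $k$, with $\Lambda_r=\{i\in\mathbb{N}:n-k+1\le i\le n\}$ ($n\ge k$), $$q_{n,\Lambda_r}:=\max_{i\in\Lambda_r}\frac{X_{(i)}}{Y_{(i)}}\ \xrightarrow{P}\ 1\quad\text{as }n\to\infty.$$
   Context: A unit exponential random variable has distribution function $1-e^{-x}$, $x\ge 0$. $\xrightarrow{P}$ denotes convergence in probability. The subscript $r$ in $\Lambda_r$ stands for "right" and is not an index. *)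

theory Defs
  imports "HOL-Probability.Probability"
begin

(* Both the sequence Z and the rank i are indexed from 1: order_stat Z n i is the i-th smallest of
   Z 1, ..., Z n, for i in {1..n}. *)
definition order_stat :: "(nat \<Rightarrow> 'a \<Rightarrow> real) \<Rightarrow> nat \<Rightarrow> nat \<Rightarrow> 'a \<Rightarrow> real" where
  "order_stat Z n i \<omega> = sort (map (\<lambda>j. Z j \<omega>) [1..<Suc n]) ! (i - 1)"

(* Natural-number subtraction truncates, so this is the intended set for n \<ge> k only. *)
definition Lambda_r :: "nat \<Rightarrow> nat \<Rightarrow> nat set" where
  "Lambda_r k n = {i. n - k + 1 \<le> i \<and> i \<le> n}"

definition max_ratio ::
  "(nat \<Rightarrow> 'a \<Rightarrow> real) \<Rightarrow> (nat \<Rightarrow> 'a \<Rightarrow> real) \<Rightarrow> nat \<Rightarrow> nat set \<Rightarrow> 'a \<Rightarrow> real" where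
  "max_ratio X Y n I \<omega> = Max ((\<lambda>i. order_stat X n i \<omega> / order_stat Y n i \<omega>) ` I)"

(* Since measure assigns 0 to non-measurable sets, measurability is demanded explicitly; only
   eventually, because a sequence need be meaningful only from some index on. *)
definition conv_in_prob :: "'a measure \<Rightarrow> (nat \<Rightarrow> 'a \<Rightarrow> real) \<Rightarrow> real \<Rightarrow> bool" where
  "conv_in_prob M Z c \<longleftrightarrow>
     (\<forall>\<^sub>F n in sequentially. Z n \<in> borel_measurable M) \<and>
     (\<forall>\<epsilon>>0. (\<lambda>n. measure M {\<omega> \<in> space M. \<bar>Z n \<omega> - c\<bar> > \<epsilon>}) \<longlonglongrightarrow> 0)"

(* Unit exponential: distribution function 1 - exp (- x) for x \<ge> 0; compare
   prob_space.exponential_distributed_iff. *)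
definition iid_unit_exponential :: "'a measure \<Rightarrow> (nat \<Rightarrow> 'a \<Rightarrow> real) \<Rightarrow> bool" where
  "iid_unit_exponential M Z \<longleftrightarrow>
     prob_space.indep_vars M (\<lambda>_. borel) Z {1..} \<and>
     (\<forall>i\<ge>1. distributed M lborel (Z i) (exponential_density 1))"

(* Joint independence of the two whole sequences, seen as random elements of the countable
   product space; Z 0 plays no role. *)
definition indep_sequences ::
  "'a measure \<Rightarrow> (nat \<Rightarrow> 'a \<Rightarrow> real) \<Rightarrow> (nat \<Rightarrow> 'a \<Rightarrow> real) \<Rightarrow> bool" where
  "indep_sequences M X Y \<longleftrightarrow>
     prob_space.indep_var M
       (Pi\<^sub>M {1..} (\<lambda>_. borel)) (\<lambda>\<omega>. \<lambda>i\<in>{1..}. X i \<omega>)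
       (Pi\<^sub>M {1..} (\<lambda>_. borel)) (\<lambda>\<omega>. \<lambda>i\<in>{1..}. Y i \<omega>)"

end

theory Submission
  imports Defs "HOL-Real_Asymp.Real_Asymp"
begin

text \<open>
  The top order statistics of an exponential sample are pinned to a deterministic sequence: for
  every fixed \<open>k\<close> and \<open>0 < \<delta> < 1\<close>, with probability tending to \<open>1\<close> all of the \<open>k\<close> largest values
  among \<open>Z\<^sub>1, \<dots>, Z\<^sub>n\<close> lie between \<open>(1 - \<delta>) ln n\<close> and \<open>(1 + \<delta>) ln n\<close>
  (lemma \<open>prob_top_order_stats_off_log\<close>). Once this is applied to both samples, the logarithm
  cancels in each of the \<open>k\<close> ratios, and all of them, hence their maximum, are close to \<open>1\<close>.

  The two halves of the concentration are elementary. Above: some sample value exceeds \<open>s\<close>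
  with probability at most \<open>n exp (- s)\<close>, by the union bound, and this is \<open>n powr (- \<delta>)\<close> for
  \<open>s = (1 + \<delta>) ln n\<close>. Below: instead of estimating the binomial number of exceedances of
  \<open>t = (1 - \<delta>) ln n\<close>, cut the sample into \<open>k\<close> blocks of length \<open>n div k\<close>. If every block contains
  an exceedance then at least \<open>k\<close> sample values exceed \<open>t\<close>. A given block contains none with
  probability \<open>(1 - exp (- t)) ^ (n div k)\<close>, by independence, and this is roughly
  \<open>exp (- n powr \<delta> / k)\<close>.
\<close>

section \<open>Order statistics and counting\<close>

text \<open>
  This turns both the measurability of order statistics and the bounds on them into statements
  about the number of sample values below a level, where sorting no longer occurs.
\<close>

lemma order_stat_le_iff:
  assumes "1 \<le> i" "i \<le> n"
  shows "order_stat Z n i \<omega> \<le> t \<longleftrightarrow> i \<le> card {j \<in> {1..n}. Z j \<omega> \<le> t}"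
proof -
  define xs where "xs = map (\<lambda>j. Z j \<omega>) [1..<Suc n]"
  define ys where "ys = sort xs"
  define S where "S = {l. l < length ys \<and> ys ! l \<le> t}"
  have len: "length ys = n" and srt: "sorted ys"
    by (simp_all add: ys_def xs_def)
  have "card {j \<in> {1..n}. Z j \<omega> \<le> t} = length (filter (\<lambda>j. Z j \<omega> \<le> t) [1..<Suc n])"
  proof -
    have "{j \<in> {1..n}. Z j \<omega> \<le> t} = set (filter (\<lambda>j. Z j \<omega> \<le> t) [1..<Suc n])"
      by auto
    then show ?thesis
      using distinct_card[of "filter (\<lambda>j. Z j \<omega> \<le> t) [1..<Suc n]"] by simp
  qed
  also have "\<dots> = length (filter (\<lambda>x. x \<le> t) xs)"
    by (simp add: xs_def filter_map o_def del: upt_Suc)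
  also have "\<dots> = length (filter (\<lambda>x. x \<le> t) ys)"
    by (simp add: ys_def filter_sort)
  also have "\<dots> = card S"
    by (simp add: length_filter_conv_card S_def)
  finally have card_eq: "card {j \<in> {1..n}. Z j \<omega> \<le> t} = card S" .
  have fin: "finite S"
    by (simp add: S_def)
  have "ys ! (i - 1) \<le> t \<longleftrightarrow> i \<le> card S"
  proof
    assume le: "ys ! (i - 1) \<le> t"
    have "{..<i} \<subseteq> S"
    proof
      fix l assume "l \<in> {..<i}"
      then have "l \<le> i - 1" "i - 1 < length ys"
        using assms len by auto
      then show "l \<in> S"
        using sorted_nth_mono[OF srt, of l "i - 1"] le by (auto simp: S_def)
    qed
    from card_mono[OF fin this] show "i \<le> card S" by simp
  next
    assume card: "i \<le> card S"
    show "ys ! (i - 1) \<le> t"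
    proof (rule ccontr)
      assume gt: "\<not> ys ! (i - 1) \<le> t"
      have "S \<subseteq> {..<i - 1}"
      proof
        fix l assume l: "l \<in> S"
        show "l \<in> {..<i - 1}"
        proof (rule ccontr)
          assume "l \<notin> {..<i - 1}"
          then have "ys ! (i - 1) \<le> ys ! l"
            using sorted_nth_mono[OF srt, of "i - 1" l] l by (auto simp: S_def)
          with gt l show False by (auto simp: S_def)
        qed
      qed
      from card_mono[OF _ this] have "card S \<le> i - 1" by simp
      with card assms show False by simp
    qed
  qed
  then show ?thesis
    by (simp only: card_eq order_stat_def ys_def xs_def)
qed

lemma borel_measurable_order_stat:
  assumes "1 \<le> i" "i \<le> n" and Z: "\<And>j. 1 \<le> j \<Longrightarrow> Z j \<in> borel_measurable M"
  shows "order_stat Z n i \<in> borel_measurable M"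
proof (rule borel_measurableI_le)
  fix t
  have card_eq: "real (card {j \<in> {1..n}. Z j \<omega> \<le> t})
      = (\<Sum>j\<in>{1..n}. indicator {x. x \<le> t} (Z j \<omega>))" for \<omega>
    by (simp add: indicator_def sum.If_cases Int_def)
  have "i \<le> card {j \<in> {1..n}. Z j \<omega> \<le> t}
      \<longleftrightarrow> real i \<le> (\<Sum>j\<in>{1..n}. indicator {x. x \<le> t} (Z j \<omega>))" for \<omega>
    unfolding card_eq[symmetric] by simp
  then have "{\<omega> \<in> space M. order_stat Z n i \<omega> \<le> t}
      = {\<omega> \<in> space M. real i \<le> (\<Sum>j\<in>{1..n}. indicator {x. x \<le> t} (Z j \<omega>))}"
    by (simp only: order_stat_le_iff[OF assms(1,2)])
  also have "\<dots> \<in> sets M"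
  proof -
    have "(\<lambda>\<omega>. indicator {x. x \<le> t} (Z j \<omega>) :: real) \<in> borel_measurable M"
      if "j \<in> {1..n}" for j
    proof -
      have [measurable]: "Z j \<in> borel_measurable M"
        using that Z by simp
      show ?thesis by measurable
    qed
    then have [measurable]: "(\<lambda>\<omega>. \<Sum>j\<in>{1..n}. indicator {x. x \<le> t} (Z j \<omega>) :: real)
        \<in> borel_measurable M"
      by (rule borel_measurable_sum)
    show ?thesis by measurable
  qed
  finally show "{\<omega> \<in> space M. order_stat Z n i \<omega> \<le> t} \<in> sets M" .
qed

text \<open>
  The witnesses of exceedance in the \<open>k\<close> blocks are distinct because the blocks are disjoint, so
  at most \<open>n - k\<close> sample values are left at or below the level \<open>t\<close>.
\<close>

lemma order_stat_greater_if_blocks_exceed: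
  assumes i: "i \<in> Lambda_r k n" and "k \<le> n"
    and blocks: "\<And>r. r < k \<Longrightarrow> \<exists>j\<in>{r * m<..r * m + m}. t < Z j \<omega>"
    and "k * m \<le> n"
  shows "t < order_stat Z n i \<omega>"
proof -
  from blocks obtain f
    where f: "\<And>r. r < k \<Longrightarrow> f r \<in> {r * m<..r * m + m} \<and> t < Z (f r) \<omega>"
    by metis
  have mono: "f r < f r'" if "r < r'" "r' < k" for r r'
  proof -
    have "f r \<le> Suc r * m" using f[of r] that by simp
    also have "\<dots> \<le> r' * m" using that by (intro mult_right_mono) auto
    also have "\<dots> < f r'" using f[of r'] that by simp
    finally show ?thesis .
  qed
  have inj: "inj_on f {..<k}"
    by (intro inj_onI) (metis mono lessThan_iff linorder_neqE_nat less_irrefl)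
  have sub: "f ` {..<k} \<subseteq> {1..n}"
  proof (rule image_subsetI)
    fix r assume "r \<in> {..<k}"
    then have "Suc r * m \<le> k * m" by (intro mult_right_mono) auto
    with f[of r] \<open>r \<in> {..<k}\<close> \<open>k * m \<le> n\<close> show "f r \<in> {1..n}" by auto
  qed
  have "{j \<in> {1..n}. Z j \<omega> \<le> t} \<subseteq> {1..n} - f ` {..<k}"
    using f by fastforce
  from card_mono[OF _ this] have "card {j \<in> {1..n}. Z j \<omega> \<le> t} \<le> card ({1..n} - f ` {..<k})"
    by simp
  also have "\<dots> = n - k"
    using sub inj by (simp add: card_Diff_subset card_image)
  finally have "card {j \<in> {1..n}. Z j \<omega> \<le> t} \<le> n - k" .
  with i \<open>k \<le> n\<close> order_stat_le_iff[of i n Z \<omega> t] show ?thesis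
    by (auto simp: Lambda_r_def)
qed

lemma order_stat_le_if_all_le:
  assumes "1 \<le> i" "i \<le> n" and "\<And>j. j \<in> {1..n} \<Longrightarrow> Z j \<omega> \<le> s"
  shows "order_stat Z n i \<omega> \<le> s"
proof -
  have "{j \<in> {1..n}. Z j \<omega> \<le> s} = {1..n}"
    using assms(3) by auto
  with order_stat_le_iff[OF assms(1,2), of Z \<omega> s] assms(2) show ?thesis by simp
qed

section \<open>Concentration of the largest values of an exponential sample\<close>

context prob_space
begin

lemma iid_unit_exponential_measurable:
  assumes "iid_unit_exponential M Z" "1 \<le> j"
  shows "Z j \<in> borel_measurable M"
  using assms distributed_measurable[of M lborel "Z j"] by (auto simp: iid_unit_exponential_def)

lemma prob_unit_exponential_block_le:
  assumes Z: "iid_unit_exponential M Z" and "0 \<le> t"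
  shows "prob {\<omega> \<in> space M. \<forall>j\<in>{a<..a + m}. Z j \<omega> \<le> t} = (1 - exp (- t)) ^ m"
proof (cases "m = 0")
  case True
  then show ?thesis by (simp add: prob_space)
next
  case False
  have indep: "indep_vars (\<lambda>_. borel) Z {1..}"
    and dist: "\<And>j. 1 \<le> j \<Longrightarrow> distributed M lborel (Z j) (exponential_density 1)"
    using Z by (auto simp: iid_unit_exponential_def)
  have "{\<omega> \<in> space M. \<forall>j\<in>{a<..a + m}. Z j \<omega> \<le> t}
      = (\<Inter>j\<in>{a<..a + m}. Z j -` {..t} \<inter> space M)"
    using False by auto
  also have "prob \<dots> = (\<Prod>j\<in>{a<..a + m}. prob (Z j -` {..t} \<inter> space M))"
    using False by (intro indep_varsD[OF indep]) auto
  also have "\<dots> = (\<Prod>j\<in>{a<..a + m}. 1 - exp (- t))"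
  proof (rule prod.cong[OF refl])
    fix j assume "j \<in> {a<..a + m}"
    then have "\<P>(x in M. Z j x \<le> t) = 1 - exp (- t * 1)"
      using dist[of j] \<open>0 \<le> t\<close> by (intro exponential_distributedD_le) auto
    moreover have "Z j -` {..t} \<inter> space M = {x \<in> space M. Z j x \<le> t}" by auto
    ultimately show "prob (Z j -` {..t} \<inter> space M) = 1 - exp (- t)" by simp
  qed
  finally show ?thesis by simp
qed

lemma prob_unit_exponential_greater:
  assumes Z: "iid_unit_exponential M Z" and "1 \<le> j" "0 \<le> s"
  shows "prob {\<omega> \<in> space M. s < Z j \<omega>} = exp (- s)"
proof -
  have "distributed M lborel (Z j) (exponential_density 1)"
    using assms by (auto simp: iid_unit_exponential_def)
  from exponential_distributedD_gt[OF this \<open>0 \<le> s\<close>] show ?thesis by simp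
qed

lemma prob_top_order_stats_outside:
  assumes Z: "iid_unit_exponential M Z" and "1 \<le> k" "k \<le> n" "0 \<le> t" "0 \<le> s"
  shows "prob {\<omega> \<in> space M. \<exists>i\<in>Lambda_r k n. order_stat Z n i \<omega> \<notin> {t<..s}}
    \<le> n * exp (- s) + k * (1 - exp (- t)) ^ (n div k)"
proof -
  define m where "m = n div k"
  have km: "k * m \<le> n" by (simp add: m_def)
  define U where "U j = {\<omega> \<in> space M. s < Z j \<omega>}" for j
  define V where "V r = {\<omega> \<in> space M. \<forall>j\<in>{r * m<..r * m + m}. Z j \<omega> \<le> t}" for r
  have U_ev: "U j \<in> events" if "j \<in> {1..n}" for j
  proof -
    have [measurable]: "Z j \<in> borel_measurable M"
      using that by (intro iid_unit_exponential_measurable[OF Z]) auto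
    show ?thesis unfolding U_def by measurable
  qed
  have V_ev: "V r \<in> events" for r
  proof -
    have "{\<omega> \<in> space M. Z j \<omega> \<le> t} \<in> events" if "j \<in> {r * m<..r * m + m}" for j
    proof -
      have [measurable]: "Z j \<in> borel_measurable M"
        using that by (intro iid_unit_exponential_measurable[OF Z]) auto
      show ?thesis by measurable
    qed
    then show ?thesis
      unfolding V_def by (intro sets.sets_Collect_finite_All) auto
  qed
  have "{\<omega> \<in> space M. \<exists>i\<in>Lambda_r k n. order_stat Z n i \<omega> \<notin> {t<..s}}
      \<subseteq> (\<Union>j\<in>{1..n}. U j) \<union> (\<Union>r\<in>{..<k}. V r)"
  proof
    fix \<omega> assume "\<omega> \<in> {\<omega> \<in> space M. \<exists>i\<in>Lambda_r k n. order_stat Z n i \<omega> \<notin> {t<..s}}"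
    then obtain i where \<omega>: "\<omega> \<in> space M" and i: "i \<in> Lambda_r k n"
      and out: "order_stat Z n i \<omega> \<notin> {t<..s}" by blast
    show "\<omega> \<in> (\<Union>j\<in>{1..n}. U j) \<union> (\<Union>r\<in>{..<k}. V r)"
    proof (rule ccontr)
      assume neg: "\<omega> \<notin> (\<Union>j\<in>{1..n}. U j) \<union> (\<Union>r\<in>{..<k}. V r)"
      have "order_stat Z n i \<omega> \<le> s"
      proof (rule order_stat_le_if_all_le)
        show "1 \<le> i" "i \<le> n" using i by (auto simp: Lambda_r_def)
        show "Z j \<omega> \<le> s" if "j \<in> {1..n}" for j
          using neg that \<omega> by (force simp: U_def)
      qed
      moreover have "t < order_stat Z n i \<omega>"
      proof (rule order_stat_greater_if_blocks_exceed[OF i \<open>k \<le> n\<close> _ km])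
        fix r assume "r < k"
        then have "\<omega> \<notin> V r" using neg by blast
        then show "\<exists>j\<in>{r * m<..r * m + m}. t < Z j \<omega>"
          using \<omega> by (auto simp: V_def not_le)
      qed
      ultimately show False using out by simp
    qed
  qed
  moreover have meas: "(\<Union>j\<in>{1..n}. U j) \<in> events" "(\<Union>r\<in>{..<k}. V r) \<in> events"
    using U_ev V_ev by auto
  ultimately have "prob {\<omega> \<in> space M. \<exists>i\<in>Lambda_r k n. order_stat Z n i \<omega> \<notin> {t<..s}}
      \<le> prob ((\<Union>j\<in>{1..n}. U j) \<union> (\<Union>r\<in>{..<k}. V r))"
    by (intro finite_measure_mono) auto
  also have "\<dots> \<le> prob (\<Union>j\<in>{1..n}. U j) + prob (\<Union>r\<in>{..<k}. V r)"
    using meas by (rule measure_Un_le)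
  also have "prob (\<Union>j\<in>{1..n}. U j) \<le> (\<Sum>j\<in>{1..n}. prob (U j))"
    using U_ev by (intro finite_measure_subadditive_finite) auto
  also have "(\<Sum>j\<in>{1..n}. prob (U j)) = n * exp (- s)"
    using prob_unit_exponential_greater[OF Z _ \<open>0 \<le> s\<close>] by (simp add: U_def)
  also have "prob (\<Union>r\<in>{..<k}. V r) \<le> (\<Sum>r<k. prob (V r))"
    using V_ev by (intro finite_measure_subadditive_finite) auto
  also have "(\<Sum>r<k. prob (V r)) = k * (1 - exp (- t)) ^ m"
    using prob_unit_exponential_block_le[OF Z \<open>0 \<le> t\<close>] by (simp add: V_def)
  finally show ?thesis by (simp add: m_def)
qed

text \<open>
  With \<open>exp (- t) = n powr (\<delta> - 1)\<close>, a block of length about \<open>n / k\<close> is expected to contain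
  \<open>n powr \<delta> / k\<close> exceedances of \<open>t = (1 - \<delta>) ln n\<close>, which grows; a level \<open>(1 + \<delta>) ln n\<close> is exceeded
  by only \<open>n powr (- \<delta>)\<close> of the \<open>n\<close> values on average.
\<close>

lemma prob_top_order_stats_off_log:
  assumes Z: "iid_unit_exponential M Z" and "1 \<le> k" and \<delta>: "0 < \<delta>" "\<delta> < 1"
  shows "(\<lambda>n. prob {\<omega> \<in> space M. \<exists>i\<in>Lambda_r k n.
            order_stat Z n i \<omega> \<notin> {(1 - \<delta>) * ln n<..(1 + \<delta>) * ln n}}) \<longlonglongrightarrow> 0"
    (is "?P \<longlonglongrightarrow> 0")
proof (rule tendsto_sandwich)
  define g where "g n = n * n powr (- (1 + \<delta>))
      + k * exp (- (n powr (- (1 - \<delta>)) * (n / k - 1)))" for n :: real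
  show "eventually (\<lambda>n. 0 \<le> ?P n) sequentially" by simp
  show "eventually (\<lambda>n. ?P n \<le> g (real n)) sequentially"
    using eventually_ge_at_top[of "k + 1"]
  proof eventually_elim
    case (elim n)
    define q where "q = exp (- ((1 - \<delta>) * ln (real n)))"
    have "0 \<le> ln (real n)" using elim by simp
    then have nonneg: "0 \<le> (1 - \<delta>) * ln (real n)" "0 \<le> (1 + \<delta>) * ln (real n)"
      using \<delta> by simp_all
    then have q: "0 \<le> q" "q \<le> 1" by (simp_all add: q_def)
    have "(1 - q) ^ (n div k) \<le> exp (- q) ^ (n div k)"
      using q exp_ge_add_one_self[of "- q"] by (intro power_mono) auto
    also have "\<dots> = exp (- q * real (n div k))"
      by (simp add: exp_of_nat_mult[symmetric] mult.commute)
    also have "\<dots> \<le> exp (- q * (n / k - 1))"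
    proof -
      have "real n / real k - 1 \<le> real (n div k)"
        using floor_divide_of_nat_eq[of n k, where 'a = real] by linarith
      from mult_left_mono[OF this q(1)] show ?thesis by simp
    qed
    finally have block: "(1 - q) ^ (n div k) \<le> exp (- (q * (n / k - 1)))" by simp
    have powr: "exp (- (a * ln (real n))) = real n powr (- a)" for a
      using elim by (simp add: powr_def)
    have "?P n \<le> n * exp (- ((1 + \<delta>) * ln n)) + k * (1 - q) ^ (n div k)"
      unfolding q_def using elim nonneg \<open>1 \<le> k\<close>
      by (intro prob_top_order_stats_outside[OF Z]) auto
    also have "\<dots> \<le> g (real n)"
      unfolding g_def powr[symmetric] q_def[symmetric]
      by (intro add_left_mono mult_left_mono block) simp
    finally show ?case .
  qed
  have "(g \<longlongrightarrow> 0) at_top"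
  proof -
    define c where "c = real k"
    have "0 < c" using \<open>1 \<le> k\<close> by (simp add: c_def)
    then show ?thesis
      using \<delta> unfolding g_def c_def[symmetric] by real_asymp
  qed
  then show "(\<lambda>n. g (real n)) \<longlonglongrightarrow> 0"
    by (rule filterlim_compose[OF _ filterlim_real_sequentially])
qed simp

end

section \<open>The maximal ratio\<close>

lemma max_ratio_attained:
  assumes "1 \<le> k" "k \<le> n"
  shows "\<exists>i\<in>Lambda_r k n. max_ratio X Y n (Lambda_r k n) \<omega> = order_stat X n i \<omega> / order_stat Y n i \<omega>"
proof -
  let ?f = "\<lambda>i. order_stat X n i \<omega> / order_stat Y n i \<omega>"
  have "finite (Lambda_r k n)" "n \<in> Lambda_r k n"
    using assms by (auto simp: Lambda_r_def)
  then have "Max (?f ` Lambda_r k n) \<in> ?f ` Lambda_r k n"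
    by (intro Max_in) auto
  then show ?thesis by (auto simp: max_ratio_def)
qed

text \<open>
  The value \<open>\<delta> = \<epsilon> / (2 + \<epsilon>)\<close> solves \<open>(1 + \<delta>) / (1 - \<delta>) = 1 + \<epsilon>\<close>. The reciprocal \<open>1 / (1 + \<epsilon>)\<close>,
  which bounds the ratio from below, is automatically at least \<open>1 - \<epsilon>\<close>.
\<close>

lemma ratio_near_one:
  fixes x y L \<epsilon> :: real
  defines "\<delta> \<equiv> \<epsilon> / (2 + \<epsilon>)"
  assumes "0 < L" "0 < \<epsilon>"
    and x: "x \<in> {(1 - \<delta>) * L<..(1 + \<delta>) * L}" and y: "y \<in> {(1 - \<delta>) * L<..(1 + \<delta>) * L}"
  shows "\<bar>x / y - 1\<bar> \<le> \<epsilon>"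
proof -
  define a where "a = (1 - \<delta>) * L"
  have "1 - \<delta> = 2 / (2 + \<epsilon>)" "1 + \<delta> = (1 + \<epsilon>) * (1 - \<delta>)"
    using \<open>0 < \<epsilon>\<close> by (simp_all add: \<delta>_def field_simps)
  then have "0 < a" and b: "(1 + \<delta>) * L = (1 + \<epsilon>) * a"
    using \<open>0 < \<epsilon>\<close> \<open>0 < L\<close> by (simp_all add: a_def)
  have x': "a < x" "x \<le> (1 + \<epsilon>) * a" and y': "a < y" "y \<le> (1 + \<epsilon>) * a"
    using x y unfolding b a_def[symmetric] by auto
  have "(1 + \<epsilon>) * a \<le> (1 + \<epsilon>) * y"
    using y' \<open>0 < \<epsilon>\<close> by (intro mult_left_mono) auto
  with x' have up: "x \<le> (1 + \<epsilon>) * y" by linarith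
  have "(1 + \<epsilon>) * a \<le> (1 + \<epsilon>) * x"
    using x' \<open>0 < \<epsilon>\<close> by (intro mult_left_mono) auto
  with y' have "y \<le> x + \<epsilon> * x" by (simp add: distrib_right)
  have low: "(1 - \<epsilon>) * y \<le> x"
  proof (cases "x \<le> y")
    case True
    then have "\<epsilon> * x \<le> \<epsilon> * y" using \<open>0 < \<epsilon>\<close> by (intro mult_left_mono) auto
    with \<open>y \<le> x + \<epsilon> * x\<close> show ?thesis by (simp add: left_diff_distrib)
  next
    case False
    moreover have "0 \<le> \<epsilon> * y" using \<open>0 < \<epsilon>\<close> \<open>0 < a\<close> y' by simp
    ultimately show ?thesis by (simp add: left_diff_distrib)
  qed
  have "0 < y" using y' \<open>0 < a\<close> by linarith
  with up low have "x / y \<le> 1 + \<epsilon>" "1 - \<epsilon> \<le> x / y"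
    by (simp_all add: pos_divide_le_eq pos_le_divide_eq)
  then show ?thesis by (simp add: abs_le_iff)
qed

theorem theorem2p3:
  fixes M :: "'a measure" and X Y :: "nat \<Rightarrow> 'a \<Rightarrow> real" and k :: nat
  assumes "prob_space M"
    and "iid_unit_exponential M X"
    and "iid_unit_exponential M Y"
    and "indep_sequences M X Y"
    and "k \<ge> 1"
  shows "conv_in_prob M (\<lambda>n. max_ratio X Y n (Lambda_r k n)) 1"
proof -
  interpret prob_space M by fact
  have order_stat_meas: "order_stat Z n i \<in> borel_measurable M"
    if "iid_unit_exponential M Z" "i \<in> Lambda_r k n" for Z n i
    using that iid_unit_exponential_measurable[of Z]
    by (intro borel_measurable_order_stat) (auto simp: Lambda_r_def)
  have fin: "finite (Lambda_r k n)" for n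
    by (simp add: Lambda_r_def)
  have "eventually (\<lambda>n. max_ratio X Y n (Lambda_r k n) \<in> borel_measurable M) sequentially"
  proof (rule always_eventually, intro allI)
    fix n
    have "(\<lambda>\<omega>. Max ((\<lambda>i. order_stat X n i \<omega> / order_stat Y n i \<omega>) ` Lambda_r k n))
        \<in> borel_measurable M"
      using order_stat_meas assms(2,3) fin
      by (intro borel_measurable_Max borel_measurable_divide) auto
    then show "max_ratio X Y n (Lambda_r k n) \<in> borel_measurable M"
      by (simp add: max_ratio_def[abs_def])
  qed
  moreover have "(\<lambda>n. prob {\<omega> \<in> space M. \<bar>max_ratio X Y n (Lambda_r k n) \<omega> - 1\<bar> > \<epsilon>}) \<longlonglongrightarrow> 0"
    if "0 < \<epsilon>" for \<epsilon>
  proof -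
    define \<delta> where "\<delta> = \<epsilon> / (2 + \<epsilon>)"
    have \<delta>: "0 < \<delta>" "\<delta> < 1"
      using that by (simp_all add: \<delta>_def)
    define bad where "bad Z n = {\<omega> \<in> space M. \<exists>i\<in>Lambda_r k n.
        order_stat Z n i \<omega> \<notin> {(1 - \<delta>) * ln n<..(1 + \<delta>) * ln n}}" for Z n
    have bad_ev: "bad Z n \<in> events" if "iid_unit_exponential M Z" for Z n
    proof -
      have "{\<omega> \<in> space M. order_stat Z n i \<omega> \<notin> {(1 - \<delta>) * ln n<..(1 + \<delta>) * ln n}} \<in> events"
        if "i \<in> Lambda_r k n" for i
        using order_stat_meas[OF \<open>iid_unit_exponential M Z\<close> that] by measurable
      then show ?thesis
        unfolding bad_def by (intro sets.sets_Collect_finite_Ex fin) auto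
    qed
    have bound: "eventually (\<lambda>n. prob {\<omega> \<in> space M. \<bar>max_ratio X Y n (Lambda_r k n) \<omega> - 1\<bar> > \<epsilon>}
        \<le> prob (bad X n) + prob (bad Y n)) sequentially"
      using eventually_ge_at_top[of "k + 1"]
    proof eventually_elim
      case (elim n)
      \<comment> \<open>Beyond \<open>n = 1\<close> the logarithm is positive and can be cancelled.\<close>
      have "0 < ln (real n)" using elim \<open>k \<ge> 1\<close> by simp
      have "{\<omega> \<in> space M. \<bar>max_ratio X Y n (Lambda_r k n) \<omega> - 1\<bar> > \<epsilon>} \<subseteq> bad X n \<union> bad Y n"
      proof
        fix \<omega> assume \<omega>: "\<omega> \<in> {\<omega> \<in> space M. \<bar>max_ratio X Y n (Lambda_r k n) \<omega> - 1\<bar> > \<epsilon>}"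
        obtain i where i: "i \<in> Lambda_r k n"
          and eq: "max_ratio X Y n (Lambda_r k n) \<omega> = order_stat X n i \<omega> / order_stat Y n i \<omega>"
          using max_ratio_attained[of k n X Y \<omega>] elim \<open>k \<ge> 1\<close> by auto
        show "\<omega> \<in> bad X n \<union> bad Y n"
        proof (rule ccontr)
          assume "\<omega> \<notin> bad X n \<union> bad Y n"
          with i \<omega> have "order_stat X n i \<omega> \<in> {(1 - \<delta>) * ln n<..(1 + \<delta>) * ln n}"
            and "order_stat Y n i \<omega> \<in> {(1 - \<delta>) * ln n<..(1 + \<delta>) * ln n}"
            by (auto simp: bad_def)
          from ratio_near_one[OF \<open>0 < ln (real n)\<close> \<open>0 < \<epsilon>\<close> this[unfolded \<delta>_def]] eq \<omega>
          show False by simp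
        qed
      qed
      then have "prob {\<omega> \<in> space M. \<bar>max_ratio X Y n (Lambda_r k n) \<omega> - 1\<bar> > \<epsilon>}
          \<le> prob (bad X n \<union> bad Y n)"
        using bad_ev assms(2,3) by (intro finite_measure_mono) auto
      also have "\<dots> \<le> prob (bad X n) + prob (bad Y n)"
        using bad_ev assms(2,3) by (intro measure_Un_le) auto
      finally show ?case .
    qed
    have "(\<lambda>n. prob (bad X n) + prob (bad Y n)) \<longlonglongrightarrow> 0"
      using tendsto_add[OF prob_top_order_stats_off_log[OF assms(2) \<open>k \<ge> 1\<close> \<delta>]
          prob_top_order_stats_off_log[OF assms(3) \<open>k \<ge> 1\<close> \<delta>]]
      by (simp add: bad_def)
    from tendsto_sandwich[OF _ bound tendsto_const this] show ?thesis by simp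
  qed
  ultimately show ?thesis
    by (simp add: conv_in_prob_def)
qed

end
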